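(* Let $a\geq 2$ be an integer. Write $\mathrm{Ap}(S(a),l_a)=\{w(0)=0,w(1),\ldots,w(l_a-1)\}$, where $w(i)$ is the least element of $S(a)$ congruent to $i$ modulo $l_a$. Then for every $x\in\{0,1,\ldots,l_a-1\}$, $w(x)=\beta(x)\,l_a+x$.
   Context: $\mathbb{N}=\{0,1,2,\ldots\}$. The Lucas series $\{l_n\}_{n\in\mathbb{N}}$ is defined by $l_0=2$, $l_1=1$, $l_{n+2}=l_{n+1}+l_n$. The reordered sequence $\{\tilde{l}_n\}_{n\in\mathbb{N}}$ is $\tilde{l}_0=l_1=1$, $\tilde{l}_1=l_0=2$, $\tilde{l}_n=l_n$ for $n\geq 2$. For $a\in\mathbb{N}$, $S(a)$ is the numerical semigroup (submonoid of $(\mathbb{N},+)$ with finite complement in $\mathbb{N}$) generated by $\{l_a\}\cup\{l_a+l_n\mid n\in\mathbb{N}\}$. For a numerical semigroup $S$ and $n\in S\setminus\{0\}$, the Apéry set is $\mathrm{Ap}(S,n)=\{s\in S\mid s-n\notin S\}$; it has exactly $n$ elements, namely, for each $i\in\{0,\ldots,n-1\}$, the least element of $S$ congruent to $i$ modulo $n$. For $x\in\mathbb{N}$, $\beta(x)=\min\left\{\sum_{i=0}^k b_i \;\middle|\; x=\sum_{i=0}^k b_i\tilde{l}_i,\ (b_0,\ldots,b_k)\in\mathbb{N}^{k+1},\ k\geq 0\right\}$. *)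

theory Defs
  imports "HOL-Number_Theory.Number_Theory"
begin

fun lucas :: "nat \<Rightarrow> nat" where
  "lucas 0 = 2"
| "lucas (Suc 0) = 1"
| "lucas (Suc (Suc n)) = lucas (Suc n) + lucas n"

definition lucas_reord :: "nat \<Rightarrow> nat" where
  "lucas_reord n = (if n = 0 then lucas 1 else if n = 1 then lucas 0 else lucas n)"

definition nat_submonoid :: "nat set \<Rightarrow> bool" where
  "nat_submonoid M \<longleftrightarrow> 0 \<in> M \<and> (\<forall>x\<in>M. \<forall>y\<in>M. x + y \<in> M)"

definition numerical_semigroup :: "nat set \<Rightarrow> bool" where
  "numerical_semigroup S \<longleftrightarrow> nat_submonoid S \<and> finite (UNIV - S)"

definition lucas_semigroup :: "nat \<Rightarrow> nat set" where
  "lucas_semigroup a = nat_submonoid hull ({lucas a} \<union> {lucas a + lucas n | n. n \<in> UNIV})"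

text \<open>The difference \<open>s - n\<close> in the Apery set is taken in the integers: with the truncated
  subtraction of natural numbers, \<open>s < n\<close> would give \<open>s - n = 0 \<in> S\<close>.\<close>

definition Apery :: "nat set \<Rightarrow> nat \<Rightarrow> nat set" where
  "Apery S n = {s \<in> S. int s - int n \<notin> int ` S}"

text \<open>For a numerical semigroup \<open>S\<close> and \<open>n > 0\<close> the minimum below is taken over a nonempty set,
  see \<open>least_in_class\<close>.\<close>

definition apery_elt :: "nat set \<Rightarrow> nat \<Rightarrow> nat \<Rightarrow> nat" where
  "apery_elt S n i = (LEAST s. s \<in> S \<and> [s = i] (mod n))"

definition lucas_beta :: "nat \<Rightarrow> nat" where
  "lucas_beta x = (LEAST m. \<exists>k b. x = (\<Sum>i\<le>k. b i * lucas_reord i) \<and> m = (\<Sum>i\<le>k. b i))"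

lemma lucas_pos: "lucas n > 0"
  by (induction n rule: lucas.induct) auto

lemma nat_submonoid_lucas_semigroup: "nat_submonoid (lucas_semigroup a)"
  unfolding lucas_semigroup_def
  by (rule hull_in) (auto simp: nat_submonoid_def)

lemma generators_in_lucas_semigroup:
  "lucas a \<in> lucas_semigroup a" "lucas a + lucas n \<in> lucas_semigroup a"
  unfolding lucas_semigroup_def by (rule hull_inc; auto)+

lemma nat_submonoid_mult:
  assumes "nat_submonoid M" "x \<in> M"
  shows "k * x \<in> M"
  using assms by (induction k) (auto simp: nat_submonoid_def)

lemma numerical_semigroup_lucas_semigroup: "numerical_semigroup (lucas_semigroup a)"
proof -
  let ?S = "lucas_semigroup a" and ?l = "lucas a"
  have sub: "nat_submonoid ?S"
    by (rule nat_submonoid_lucas_semigroup)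
  have gen: "?l \<in> ?S" "?l + 1 \<in> ?S"
    using generators_in_lucas_semigroup(1)[of a] generators_in_lucas_semigroup(2)[of a 1] by auto
  have "x \<in> ?S" if "x \<ge> ?l * ?l" for x
  proof -
    let ?q = "x div ?l" and ?r = "x mod ?l"
    have "?l \<le> ?q"
      using that lucas_pos[of a] by (simp add: less_eq_div_iff_mult_less_eq)
    moreover have "?r < ?l"
      using lucas_pos[of a] by simp
    ultimately obtain d where d: "?q = d + ?r"
      by (metis add.commute le_add_diff_inverse less_imp_le order_trans)
    have "x = ?q * ?l + ?r" by simp
    also have "\<dots> = d * ?l + ?r * (?l + 1)"
      unfolding d by (simp add: algebra_simps)
    finally have "x = d * ?l + ?r * (?l + 1)" .
    moreover have "d * ?l + ?r * (?l + 1) \<in> ?S"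
      using sub nat_submonoid_mult[OF sub gen(1)] nat_submonoid_mult[OF sub gen(2)]
      unfolding nat_submonoid_def by blast
    ultimately show ?thesis by metis
  qed
  then have "UNIV - ?S \<subseteq> {..<?l * ?l}"
    by (auto simp: not_less[symmetric])
  then show ?thesis
    using sub finite_subset unfolding numerical_semigroup_def by blast
qed

lemma least_in_class:
  assumes "numerical_semigroup S" "n > 0"
  shows "apery_elt S n i \<in> S" "[apery_elt S n i = i] (mod n)"
    and "\<And>s. s \<in> S \<Longrightarrow> [s = i] (mod n) \<Longrightarrow> apery_elt S n i \<le> s"
proof -
  obtain N where "UNIV - S \<subseteq> {..<N}"
    using assms(1) finite_nat_bounded unfolding numerical_semigroup_def by blast
  moreover have "N \<le> N * n + i"
    using assms(2) by (simp add: trans_le_add1)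
  ultimately have "N * n + i \<in> S"
    by (meson DiffI UNIV_I lessThan_iff not_le subsetD)
  then have "N * n + i \<in> S \<and> [N * n + i = i] (mod n)"
    by (simp add: cong_def)
  from LeastI[of "\<lambda>s. s \<in> S \<and> [s = i] (mod n)", OF this]
  show "apery_elt S n i \<in> S" "[apery_elt S n i = i] (mod n)"
    unfolding apery_elt_def by auto
  show "\<And>s. s \<in> S \<Longrightarrow> [s = i] (mod n) \<Longrightarrow> apery_elt S n i \<le> s"
    unfolding apery_elt_def by (simp add: Least_le)
qed

lemma lucas_beta_attained:
  "\<exists>k b. x = (\<Sum>i\<le>k. b i * lucas_reord i) \<and> lucas_beta x = (\<Sum>i\<le>k. b i)"
proof -
  have "\<exists>k b. x = (\<Sum>i\<le>k. b i * lucas_reord i) \<and> x = (\<Sum>i\<le>k. b i)"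
    by (rule exI[of _ 0], rule exI[of _ "\<lambda>_. x"]) (simp add: lucas_reord_def)
  then show ?thesis
    unfolding lucas_beta_def by (rule LeastI)
qed

end

theory Submission
  imports Defs
begin

text \<open>
  Write \<open>L\<close> for \<open>lucas a\<close> and \<open>\<beta>\<close> for \<open>lucas_beta\<close>. The claim amounts to
  \<open>lucas_semigroup a = {s. \<beta> (s mod L) \<le> s div L}\<close>, so one has to see that the right-hand side
  is closed under addition. As \<open>\<beta>\<close> is subadditive, only a carry can cause trouble, and it does not:
  \<open>\<beta> (z - L) \<le> \<beta> z\<close> for \<open>L \<le> z < 2 * L\<close>. Indeed, a representation of \<open>z\<close> can be
  rewritten, without becoming longer, into one without repeated or consecutive indices. A
  representation of this form with all indices below \<open>a\<close> has a sum less than \<open>L\<close>, so that of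
  \<open>z\<close> contains \<open>lucas a\<close>, which can be removed, or \<open>lucas (a + 1)\<close>, which can be replaced by
  \<open>lucas (a - 1)\<close>.
\<close>

lemma lucas_mono:
  assumes "m \<le> n" "1 \<le> m"
  shows "lucas m \<le> lucas n"
  using assms
proof (induction rule: dec_induct)
  case (step k)
  then have "lucas k \<le> lucas (Suc k)"
    by (cases k) auto
  with step show ?case
    by simp
qed simp

text \<open>As \<open>lucas 0 = 2\<close> exceeds \<open>lucas 1\<close>, monotonicity only starts
  at index 1, and index 0 is compared with \<open>lucas 2 = 3\<close> instead.\<close>

lemma lucas_less:
  assumes "n < a" "2 \<le> a"
  shows "lucas n < lucas a"
proof (cases "n = 0")
  case True
  then show ?thesis
    using lucas_mono[of 2 a] assms by (simp add: numeral_2_eq_2)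
next
  case False
  obtain k where k: "a = Suc (Suc k)"
    using assms(2) by (metis add_2_eq_Suc le_Suc_ex)
  have "lucas n \<le> lucas (Suc k)"
    using False assms k by (intro lucas_mono) auto
  then show ?thesis
    using lucas_pos[of k] k by simp
qed

section \<open>Representations as multisets of indices\<close>

text \<open>A representation of a number is modelled by the multiset of the Lucas indices it uses.\<close>

abbreviation lucas_sum :: "nat multiset \<Rightarrow> nat" where
  "lucas_sum M \<equiv> \<Sum>i\<in>#M. lucas i"

lemma lucas_sum_sum: "lucas_sum (\<Sum>i\<le>k. F i) = (\<Sum>i\<le>(k::nat). lucas_sum (F i))"
  by (induction k) auto

lemma ex_multiset_lucas_beta:
  obtains M where "lucas_sum M = x" "size M = lucas_beta x"
proof -
  obtain k b where kb: "x = (\<Sum>i\<le>k. b i * lucas_reord i)" "lucas_beta x = (\<Sum>i\<le>k. b i)"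
    using lucas_beta_attained by blast
  \<comment> \<open>\<open>\<sigma>\<close> swaps 0 and 1, which undoes the reordering in
    \<open>lucas_reord\<close>.\<close>
  define \<sigma> where "\<sigma> i = (if i = 0 then 1 else if i = 1 then 0 else i)" for i :: nat
  have "lucas_reord i = lucas (\<sigma> i)" for i
    by (simp add: lucas_reord_def \<sigma>_def)
  then have "lucas_sum (\<Sum>i\<le>k. replicate_mset (b i) (\<sigma> i)) = x"
    by (simp add: kb(1) lucas_sum_sum)
  moreover have "size (\<Sum>i\<le>k. replicate_mset (b i) (\<sigma> i)) = lucas_beta x"
    by (simp add: kb(2) size_multiset_sum)
  ultimately show ?thesis
    using that by blast
qed

lemma ex_coefficients_lucas_sum:
  "\<exists>k b. lucas_sum M = (\<Sum>i\<le>k. b i * lucas_reord i) \<and> size M = (\<Sum>i\<le>k. b i)"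
proof (induction M)
  case empty
  show ?case
    by (rule exI[of _ 0], rule exI[of _ "\<lambda>_. 0"]) simp
next
  case (add j M)
  then obtain k b where
    kb: "lucas_sum M = (\<Sum>i\<le>k. b i * lucas_reord i)" "size M = (\<Sum>i\<le>k. b i)"
    by blast
  define j' where "j' = (if j = 0 then 1 else if j = 1 then 0 else j)"
  \<comment> \<open>The values of \<open>b\<close> beyond \<open>k\<close> are arbitrary, so they
    are set to 0 before the range is extended to \<open>k + j'\<close>.\<close>
  define b' where "b' i = (if i \<le> k then b i else 0) + (if i = j' then 1 else 0)" for i
  \<comment> \<open>Taking \<open>f\<close> to be \<open>lucas_reord\<close> gives the sum, and the
    constant 1 gives the size.\<close>
  have *: "(\<Sum>i\<le>k + j'. b' i * f i) = (\<Sum>i\<le>k. b i * f i) + f j'" for f :: "nat \<Rightarrow> nat"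
  proof -
    have "(\<Sum>i\<le>k + j'. b' i * f i)
        = (\<Sum>i\<le>k + j'. if i \<le> k then b i * f i else 0) + (\<Sum>i\<le>k + j'. if i = j' then f i else 0)"
      unfolding sum.distrib[symmetric] by (intro sum.cong) (auto simp: b'_def algebra_simps)
    also have "(\<Sum>i\<le>k + j'. if i \<le> k then b i * f i else 0) = (\<Sum>i\<le>k. b i * f i)"
      by (intro sum.mono_neutral_cong_right) auto
    finally show ?thesis
      by simp
  qed
  have "lucas_reord j' = lucas j"
    by (simp add: lucas_reord_def j'_def)
  then have "lucas_sum (add_mset j M) = (\<Sum>i\<le>k + j'. b' i * lucas_reord i)"
    using *[of lucas_reord] kb(1) by simp
  moreover have "size (add_mset j M) = (\<Sum>i\<le>k + j'. b' i)"
    using *[of "\<lambda>_. 1"] kb(2) by simp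
  ultimately show ?case
    by blast
qed

lemma lucas_beta_le: "lucas_beta (lucas_sum M) \<le> size M"
  unfolding lucas_beta_def by (rule Least_le, rule ex_coefficients_lucas_sum)

lemma lucas_beta_0 [simp]: "lucas_beta 0 = 0"
  using lucas_beta_le[of "{#}"] by simp

lemma lucas_beta_lucas_le: "lucas_beta (lucas n) \<le> 1"
  using lucas_beta_le[of "{#n#}"] by simp

lemma lucas_beta_add_le: "lucas_beta (x + y) \<le> lucas_beta x + lucas_beta y"
proof -
  obtain M N where "lucas_sum M = x" "size M = lucas_beta x" "lucas_sum N = y" "size N = lucas_beta y"
    by (metis ex_multiset_lucas_beta)
  then show ?thesis
    using lucas_beta_le[of "M + N"] by simp
qed

section \<open>Normal representations\<close>

text \<open>For \<open>i = j\<close> the inclusion says that \<open>i\<close> occurs twice, so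
  repetitions are excluded too. The pair 0, 2 is excluded because
  \<open>lucas 0 + lucas 2 = 5\<close> already exceeds \<open>lucas 3 = 4\<close>.\<close>

definition normal_rep :: "nat multiset \<Rightarrow> bool" where
  "normal_rep M \<longleftrightarrow> (\<forall>i j. {#i, j#} \<subseteq># M \<longrightarrow> i \<le> j \<longrightarrow> i + 2 \<le> j \<and> \<not> (i = 0 \<and> j = 2))"

lemma normal_rep_subset: "normal_rep M \<Longrightarrow> N \<subseteq># M \<Longrightarrow> normal_rep N"
  unfolding normal_rep_def using subset_mset.order_trans by blast

lemma normal_rep_add_mset:
  assumes "normal_rep (add_mset j M)" "i \<in># M" "i \<le> j"
  shows "i + 2 \<le> j" "\<not> (i = 0 \<and> j = 2)"
proof -
  have "{#i, j#} \<subseteq># add_mset j M"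
    using assms(2) by (simp add: add_mset_commute[of i j])
  then show "i + 2 \<le> j" "\<not> (i = 0 \<and> j = 2)"
    using assms unfolding normal_rep_def by blast+
qed

text \<open>The sum of the squares serves as the potential whose maximization yields a normal representation.\<close>

lemma ex_exchange:
  assumes "i \<le> j" "\<not> (i + 2 \<le> j \<and> \<not> (i = 0 \<and> j = 2))"
  shows "\<exists>N. lucas_sum N = lucas i + lucas j \<and> size N \<le> 2 \<and>
           (lucas i)\<^sup>2 + (lucas j)\<^sup>2 < (\<Sum>k\<in>#N. (lucas k)\<^sup>2)"
proof -
  \<comment> \<open>The five exchanges are 2 + 2 = 1 + 3, 1 + 1 = 2,
    \<open>2 * lucas (m + 2) = lucas (m + 3) + lucas m\<close>, the Lucas recurrence, and 2 + 3 = 1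
    + 4.\<close>
  consider "i = 0" "j = 0" | "i = 1" "j = 1" | m where "i = m + 2" "j = m + 2"
    | "j = Suc i" | "i = 0" "j = 2"
    using assms by (cases "i = j"; cases i; cases "i - 1") (auto simp: le_Suc_eq not_le less_Suc_eq)
  then show ?thesis
  proof cases
    case 1
    then show ?thesis
      by (intro exI[of _ "{#1, 2#}"]) (simp add: numeral_2_eq_2)
  next
    case 2
    then show ?thesis
      by (intro exI[of _ "{#0#}"]) simp
  next
    case (3 m)
    then show ?thesis
      using lucas_pos[of "Suc m"]
      by (intro exI[of _ "{#m + 3, m#}"])
        (simp add: numeral_3_eq_3 power2_eq_square algebra_simps)
  next
    case 4
    then show ?thesis
      using lucas_pos[of i] lucas_pos[of j]
      by (intro exI[of _ "{#Suc (Suc i)#}"]) (simp add: power2_eq_square algebra_simps)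
  next
    case 5
    then show ?thesis
      by (intro exI[of _ "{#1, 3#}"]) (simp add: numeral_2_eq_2 numeral_3_eq_3)
  qed
qed

text \<open>Bounds the potential in terms of the represented number alone, so that a maximum
  exists.\<close>

lemma sum_mset_squares_le: "(\<Sum>k\<in>#M. (f k)\<^sup>2) \<le> (\<Sum>k\<in>#M. f k)\<^sup>2" for f :: "'a \<Rightarrow> nat"
  by (induction M) (auto simp: power2_sum)

lemma ex_normal_rep:
  obtains N where "lucas_sum N = lucas_sum M" "size N \<le> size M" "normal_rep N"
proof -
  let ?P = "\<lambda>N. lucas_sum N = lucas_sum M \<and> size N \<le> size M"
  let ?q = "\<lambda>N. \<Sum>k\<in>#N. (lucas k)\<^sup>2"
  have "\<exists>N. ?P N \<and> (\<forall>K. ?P K \<longrightarrow> ?q K \<le> ?q N)"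
  proof (rule ex_has_greatest_nat[of ?P M _ "Suc ((lucas_sum M)\<^sup>2)"])
    show "\<forall>K. ?P K \<longrightarrow> ?q K < Suc ((lucas_sum M)\<^sup>2)"
      using sum_mset_squares_le[of lucas] by (metis le_imp_less_Suc)
  qed simp
  then obtain N where N: "?P N" and max: "\<And>K. ?P K \<Longrightarrow> ?q K \<le> ?q N"
    by blast
  have "normal_rep N"
    unfolding normal_rep_def
  proof (intro allI impI, rule ccontr)
    fix i j
    assume sub: "{#i, j#} \<subseteq># N" and "i \<le> j" "\<not> (i + 2 \<le> j \<and> \<not> (i = 0 \<and> j = 2))"
    then obtain K where K: "lucas_sum K = lucas i + lucas j" "size K \<le> 2"
        "(lucas i)\<^sup>2 + (lucas j)\<^sup>2 < ?q K"
      using ex_exchange by blast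
    obtain R where R: "N = {#i, j#} + R"
      using sub by (metis subset_mset.add_diff_inverse)
    have "?P (K + R)"
      using N K R by simp
    then have "?q (K + R) \<le> ?q N"
      by (rule max)
    then show False
      using K(3) R by simp
  qed
  with N that show ?thesis
    by blast
qed

text \<open>A Zeckendorf-type bound: if the top index \<open>n + 1\<close> occurs, the other indices
  are below \<open>n\<close> and sum to less than \<open>lucas n\<close>, and the recurrence
  concludes.\<close>

lemma lucas_sum_normal_rep_less:
  assumes "normal_rep M" "\<And>i. i \<in># M \<Longrightarrow> i < n + 2"
  shows "lucas_sum M < lucas (n + 2)"
  using assms
proof (induction n arbitrary: M rule: less_induct)
  case (less n)
  show ?case
  proof (cases "n + 1 \<in># M")
    case True
    then obtain R where R: "M = add_mset (n + 1) R"
      by (meson mset_add)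
    have small: "i + 2 \<le> n + 1 \<and> \<not> (i = 0 \<and> n + 1 = 2)" if "i \<in># R" for i
      using normal_rep_add_mset[of "n + 1" R i] less.prems that unfolding R by force
    show ?thesis
    \<comment> \<open>For \<open>n = 1\<close> only index 0 could remain beside index 2, and this is
      the pair excluded in \<open>normal_rep\<close>.\<close>
    proof (cases "n < 2")
      case True
      then have "R = {#}"
        using small by (cases R) force+
      then show ?thesis
        using lucas_pos[of n] by (simp add: R)
    next
      case False
      have "normal_rep R"
        using less.prems(1) R by (auto intro: normal_rep_subset)
      then have "lucas_sum R < lucas (n - 2 + 2)"
        using small False by (intro less.IH) force+
      also have "n - 2 + 2 = n"
        using False by simp
      finally show ?thesis
        by (simp add: R)
    qed
  next
    case False
    then have *: "i < n + 1" if "i \<in># M" for i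
      using less.prems(2)[OF that] that by (cases "i = n + 1") auto
    show ?thesis
    proof (cases n)
      case 0
      have "M = {#} \<or> M = {#0#}"
      proof (cases M)
        case (add j R)
        have "i \<notin># R" for i
          using normal_rep_add_mset[of j R i] less.prems(1) *[of i] *[of j] 0 add by auto
        then have "R = {#}"
          by auto
        then show ?thesis
          using *[of j] 0 add by simp
      qed simp
      then show ?thesis
        using 0 by (auto simp: numeral_2_eq_2)
    next
      case (Suc m)
      then have "lucas_sum M < lucas (m + 2)"
        using less.prems(1) * by (intro less.IH) auto
      also have "\<dots> \<le> lucas (n + 2)"
        using Suc by (intro lucas_mono) auto
      finally show ?thesis .
    qed
  qed
qed

section \<open>Carries and the lower bound\<close>

lemma lucas_beta_diff_le:
  assumes "2 \<le> a" "lucas a \<le> z" "z < 2 * lucas a"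
  shows "lucas_beta (z - lucas a) \<le> lucas_beta z"
proof -
  obtain M where M: "lucas_sum M = z" "size M \<le> lucas_beta z" "normal_rep M"
    by (metis ex_multiset_lucas_beta ex_normal_rep)
  have "a - 2 + 2 = a"
    using assms(1) by simp
  then obtain n where n: "n \<in># M" "a \<le> n"
    using lucas_sum_normal_rep_less[of M "a - 2"] M assms(2) by (metis not_less)
  obtain R where R: "M = add_mset n R"
    using n(1) by (meson mset_add)
  obtain c where c: "a = Suc c" "1 \<le> c"
    using assms(1) by (cases a) auto
  \<comment> \<open>\<open>lucas (a + 2) = 2 * lucas a + lucas (a - 1)\<close> is already larger
    than \<open>z\<close>.\<close>
  have "n < a + 2"
  proof (rule ccontr)
    assume "\<not> n < a + 2"
    then have "lucas (a + 2) \<le> lucas n"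
      by (intro lucas_mono) auto
    then show False
      using M(1) R assms(3) c by simp
  qed
  then consider "n = a" | "n = Suc a"
    using n(2) by linarith
  then show ?thesis
  proof cases
    case 1
    then have "lucas_sum R = z - lucas a"
      using M(1) R by simp
    then show ?thesis
      using lucas_beta_le[of R] M(2) R by simp
  next
    case 2
    then have "lucas_sum (add_mset c R) = z - lucas a"
      using M(1) R c by simp
    then show ?thesis
      using lucas_beta_le[of "add_mset c R"] M(2) R by simp
  qed
qed

lemma lucas_beta_mod_le_div:
  assumes "2 \<le> a" "s \<in> lucas_semigroup a"
  shows "lucas_beta (s mod lucas a) \<le> s div lucas a"
proof -
  define L where "L = lucas a"
  have L: "0 < L"
    by (simp add: L_def lucas_pos)
  define T where "T = {s. lucas_beta (s mod L) \<le> s div L}"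
  have T_add: "s + t \<in> T" if "s \<in> T" "t \<in> T" for s t
  proof (cases "s mod L + t mod L < L")
    case True
    then have "(s + t) mod L = s mod L + t mod L" "(s + t) div L = s div L + t div L"
      by (simp_all add: mod_add_eq[symmetric, of s] div_add1_eq[of s])
    then show ?thesis
      using that lucas_beta_add_le[of "s mod L" "t mod L"] by (simp add: T_def)
  next
    \<comment> \<open>The carry raises the quotient by 1 while \<open>lucas_beta\<close> of the
      remainder does not grow.\<close>
    case False
    let ?z = "s mod L + t mod L"
    have z: "L \<le> ?z" "?z < 2 * L"
      using False mod_less_divisor[OF L, of s] mod_less_divisor[OF L, of t] by linarith+
    have "?z mod L = ?z - L" "?z div L = 1"
      using z L by (simp_all add: le_mod_geq div_nat_eqI)
    then have "(s + t) mod L = ?z - L" "(s + t) div L = s div L + t div L + 1"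
      by (simp_all add: mod_add_eq[symmetric, of s] div_add1_eq[of s])
    moreover have "lucas_beta (?z - L) \<le> lucas_beta ?z"
      using lucas_beta_diff_le[OF assms(1)] z by (simp add: L_def)
    ultimately show ?thesis
      using that lucas_beta_add_le[of "s mod L" "t mod L"] by (simp add: T_def)
  qed
  have T_L: "L \<in> T"
    using L by (simp add: T_def)
  have T_small: "L + lucas n \<in> T" if "n < a" for n
    using lucas_less[OF that assms(1)] lucas_beta_lucas_le[of n] L
    by (simp add: T_def L_def)
  \<comment> \<open>From index \<open>a\<close> on, the Lucas numbers themselves lie in
    \<open>T\<close>: the first two are \<open>L\<close> and \<open>L + lucas (a - 1)\<close>, and
    the recurrence yields the rest. Hence only the generators with \<open>n < a\<close> need a
    direct check.\<close>
  have "lucas (a + m) \<in> T" for m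
  proof (induction m rule: induct_nat_012)
    case 0
    show ?case
      using T_L by (simp add: L_def)
  next
    case 1
    obtain c where "a = Suc c"
      using assms(1) by (cases a) auto
    then show ?case
      using T_small[of c] by (simp add: L_def)
  next
    case (ge2 m)
    then show ?case
      using T_add[of "lucas (a + Suc m)" "lucas (a + m)"] by simp
  qed
  then have "L + lucas n \<in> T" for n
    using T_small[of n] T_add[OF T_L] by (metis le_Suc_ex not_less)
  then have "lucas_semigroup a \<subseteq> T"
    unfolding lucas_semigroup_def
  proof (intro hull_minimal)
    show "nat_submonoid T"
      using T_add by (auto simp: nat_submonoid_def T_def)
  qed (use T_L in \<open>auto simp: L_def\<close>)
  then show ?thesis
    using assms(2) by (auto simp: T_def L_def)
qed

section \<open>The upper bound and the Apery set\<close>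

text \<open>Each index \<open>i\<close> in \<open>M\<close> contributes one generator
  \<open>lucas a + lucas i\<close>. For a shortest \<open>M\<close> this bounds the least element of
  its class from above.\<close>

lemma size_mult_add_lucas_sum_in: "size M * lucas a + lucas_sum M \<in> lucas_semigroup a"
proof (induction M)
  case empty
  show ?case
    using nat_submonoid_lucas_semigroup[of a] by (simp add: nat_submonoid_def)
next
  case (add i M)
  then have "(lucas a + lucas i) + (size M * lucas a + lucas_sum M) \<in> lucas_semigroup a"
    using nat_submonoid_lucas_semigroup[of a] generators_in_lucas_semigroup(2)[of a i]
    unfolding nat_submonoid_def by blast
  then show ?case
    by (simp add: algebra_simps)
qed

lemma Apery_eq_image_apery_elt:
  assumes S: "numerical_semigroup S" and n: "n \<in> S" "0 < n"
  shows "Apery S n = apery_elt S n ` {0..<n}"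
proof (intro equalityI subsetI)
  note w = least_in_class[OF S n(2)]
  fix s
  assume s: "s \<in> Apery S n"
  then have "s \<in> S" "int s - int n \<notin> int ` S"
    by (auto simp: Apery_def)
  define t where "t = apery_elt S n (s mod n)"
  have t: "t \<in> S" "[t = s] (mod n)" "t \<le> s"
    using w(1,2)[of "s mod n"] w(3)[of s "s mod n"] \<open>s \<in> S\<close> by (auto simp: t_def cong_def)
  \<comment> \<open>Otherwise \<open>s\<close> exceeds \<open>t\<close> by a positive multiple of
    \<open>n\<close>, so \<open>s - n\<close> is \<open>t\<close> plus a multiple of
    \<open>n\<close> and lies in \<open>S\<close>.\<close>
  have "t = s"
  proof (rule ccontr)
    assume "t \<noteq> s"
    obtain k where k: "s = t + k * n"
      using t(2,3) by (metis cong_le_nat cong_sym add.commute mult.commute)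
    with \<open>t \<noteq> s\<close> obtain m where "k = Suc m"
      by (cases k) auto
    with k have m: "s = t + m * n + n"
      by simp
    have "nat_submonoid S"
      using S by (simp add: numerical_semigroup_def)
    then have "t + m * n \<in> S"
      using t(1) nat_submonoid_mult[of S n m] n(1) by (auto simp: nat_submonoid_def)
    moreover have "int s - int n = int (t + m * n)"
      using m by simp
    ultimately show False
      using \<open>int s - int n \<notin> int ` S\<close> by (metis image_eqI)
  qed
  then show "s \<in> apery_elt S n ` {0..<n}"
    using n(2) unfolding t_def by (intro image_eqI[of _ _ "s mod n"]) auto
next
  note w = least_in_class[OF S n(2)]
  fix s
  assume "s \<in> apery_elt S n ` {0..<n}"
  then obtain i where i: "s = apery_elt S n i"
    by blast
  have "int s - int n \<notin> int ` S"
  proof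
    assume "int s - int n \<in> int ` S"
    then obtain r where r: "r \<in> S" "s = r + n"
      by force
    then have "[r = i] (mod n)"
      using w(2)[of i] i by (simp add: cong_def)
    \<comment> \<open>\<open>r\<close> would be a smaller element of \<open>S\<close> in the class
      of \<open>i\<close>.\<close>
    then show False
      using w(3)[OF r(1)] r(2) i n(2) by force
  qed
  then show "s \<in> Apery S n"
    using w(1)[of i] i by (simp add: Apery_def)
qed

theorem theorem4p6:
  fixes a :: nat
  assumes "a \<ge> 2"
  shows "let w = apery_elt (lucas_semigroup a) (lucas a) in
    Apery (lucas_semigroup a) (lucas a) = w ` {0..<lucas a} \<and> w 0 = 0 \<and>
    (\<forall>x\<in>{0..<lucas a}. w x = lucas_beta x * lucas a + x)"
proof -
  let ?S = "lucas_semigroup a" and ?L = "lucas a"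
  note w = least_in_class[OF numerical_semigroup_lucas_semigroup[of a] lucas_pos[of a]]
  have beta: "apery_elt ?S ?L x = lucas_beta x * ?L + x" if "x < ?L" for x
  proof (rule antisym)
    obtain M where "lucas_sum M = x" "size M = lucas_beta x"
      by (rule ex_multiset_lucas_beta)
    then have "lucas_beta x * ?L + x \<in> ?S"
      using size_mult_add_lucas_sum_in[of M a] by simp
    then show "apery_elt ?S ?L x \<le> lucas_beta x * ?L + x"
      by (rule w(3)) (simp add: cong_def)
  next
    let ?s = "apery_elt ?S ?L x"
    have "?s mod ?L = x"
      using w(2)[of x] that by (simp add: cong_def)
    then have "lucas_beta x * ?L + x \<le> ?s div ?L * ?L + ?s mod ?L"
      using lucas_beta_mod_le_div[OF assms w(1)[of x]] by simp
    then show "lucas_beta x * ?L + x \<le> ?s"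
      by simp
  qed
  have "Apery ?S ?L = apery_elt ?S ?L ` {0..<?L}"
    by (intro Apery_eq_image_apery_elt numerical_semigroup_lucas_semigroup
        generators_in_lucas_semigroup lucas_pos)
  \<comment> \<open>\<open>w 0 = 0\<close> is the case \<open>x = 0\<close> of \<open>beta\<close>,
    through \<open>lucas_beta_0\<close>.\<close>
  then show ?thesis
    using beta lucas_pos[of a] by (simp add: Let_def)
qed

end
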